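(* $\mathcal{M}^{acc}$ is a strongly internal, finite-independent, shift invariant, symmetric, homogeneous, convex, closed and accumulated generalized mean.
   Context: $H'$ is the set of accumulation points of $H\subset\mathbb{R}$, $cl(H)$ its closure, $A-B$ is set difference. For a finite nonempty set $F\subset\mathbb{R}$, $\mathcal{A}(F)$ is the arithmetic mean of its elements. For infinite bounded $H$: $\varliminf H=\inf H'$, $\varlimsup H=\sup H'$. $H+x=\{h+x:h\in H\}$, $\alpha H=\{\alpha h:h\in H\}$. Set $H^{(0)}=H$, $H^{(n+1)}=(H^{(n)})'$ for $n\ge 0$. Let $lev(H)=n$ if $H^{(n)}\neq\emptyset$ and $H^{(n+1)}=\emptyset$ ($n\ge 0$ an integer); otherwise $lev(H)=+\infty$. For bounded $H$ with $lev(H)=n<+\infty$ the set $H^{(n)}$ is finite and nonempty, and $\mathcal{M}^{acc}(H)=\mathcal{A}(H^{(n)})$. $Dom(\mathcal{M}^{acc})$ is the set of bounded $H\subset\mathbb{R}$ with $lev(H)<+\infty$. A generalized mean is a function $\mathcal{K}:Dom(\mathcal{K})\to\mathbb{R}$, where $Dom(\mathcal{K})$ consists of some bounded subsets of $\mathbb{R}$, with $\inf H\le\mathcal{K}(H)\le\sup H$ for all $H\in Dom(\mathcal{K})$. Properties of $\mathcal{K}$: - strongly internal: $\varliminf H\le\mathcal{K}(H)\le\varlimsup H$ for all infinite $H\in Dom(\mathcal{K})$; - finite-independent: if $H\in Dom(\mathcal{K})$ is infinite and $V$ is finite then $H\cup V,\ H-V\in Dom(\mathcal{K})$ and $\mathcal{K}(H)=\mathcal{K}(H\cup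 V)=\mathcal{K}(H-V)$; - shift invariant: if $x\in\mathbb{R}$, $H\in Dom(\mathcal{K})$ then $H+x\in Dom(\mathcal{K})$ and $\mathcal{K}(H+x)=\mathcal{K}(H)+x$; - symmetric: if $H\in Dom(\mathcal{K})$ and $s\in\mathbb{R}$ is such that for all $x$, $s+x\in H\Leftrightarrow s-x\in H$, then $\mathcal{K}(H)=s$; - homogeneous: if $H\in Dom(\mathcal{K})$ and $\alpha\in\mathbb{R}$ then $\alpha H\in Dom(\mathcal{K})$ and $\mathcal{K}(\alpha H)=\alpha\mathcal{K}(H)$; - convex: if $I$ is a closed interval, $\mathcal{K}(H)\in I$, $L\subset I$, and $H,H\cup L\in Dom(\mathcal{K})$, then $\mathcal{K}(H\cup L)\in I$; - closed: if $H,cl(H)\in Dom(\mathcal{K})$ then $\mathcal{K}(cl(H))=\mathcal{K}(H)$; - accumulated: if $H,H'\in Dom(\mathcal{K})$ then $\mathcal{K}(H')=\mathcal{K}(H)$. *)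

theory Defs
  imports "HOL-Analysis.Analysis" "HOL-Library.Extended_Nat"
begin

definition derived_set :: "real set \<Rightarrow> real set" where
  "derived_set H = {x. x islimpt H}"

definition iter_derived :: "nat \<Rightarrow> real set \<Rightarrow> real set" where
  "iter_derived n H = (derived_set ^^ n) H"

definition acc_liminf :: "real set \<Rightarrow> real" where
  "acc_liminf H = Inf (derived_set H)"

definition acc_limsup :: "real set \<Rightarrow> real" where
  "acc_limsup H = Sup (derived_set H)"

definition arith_mean :: "real set \<Rightarrow> real" where
  "arith_mean F = (\<Sum>x\<in>F. x) / real (card F)"

definition has_lev :: "real set \<Rightarrow> nat \<Rightarrow> bool" where
  "has_lev H n \<longleftrightarrow> iter_derived n H \<noteq> {} \<and> iter_derived (Suc n) H = {}"

text \<open>The \<open>THE\<close> is well defined, see \<open>lev_eq_enat_iff\<close>.  The empty set has level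
  \<open>\<infinity>\<close>.\<close>

definition lev :: "real set \<Rightarrow> enat" where
  "lev H = (if \<exists>n. has_lev H n then enat (THE n. has_lev H n) else \<infinity>)"

lemma iter_derived_empty_mono:
  assumes "iter_derived m H = {}" "m \<le> n"
  shows "iter_derived n H = {}"
  using assms(2,1)
proof (induction n rule: dec_induct)
  case (step n)
  then have "(derived_set ^^ n) H = {}"
    by (simp add: iter_derived_def)
  then show ?case
    by (simp add: iter_derived_def derived_set_def)
qed

lemma has_lev_unique:
  assumes "has_lev H m" "has_lev H n"
  shows "m = n"
proof (rule ccontr)
  assume "m \<noteq> n"
  then have "Suc m \<le> n \<or> Suc n \<le> m" by linarith
  then show False
    using assms iter_derived_empty_mono unfolding has_lev_def by blast
qed

lemma lev_eq_enat_iff: "lev H = enat n \<longleftrightarrow> has_lev H n"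
proof
  assume "lev H = enat n"
  then have ex: "\<exists>k. has_lev H k" and eq: "(THE k. has_lev H k) = n"
    by (auto simp: lev_def split: if_splits)
  from ex obtain k where "has_lev H k" by blast
  moreover from this have "(THE k. has_lev H k) = k"
    by (rule the_equality) (use \<open>has_lev H k\<close> has_lev_unique in blast)
  ultimately show "has_lev H n" using eq by simp
next
  assume h: "has_lev H n"
  then have "(THE k. has_lev H k) = n"
    by (rule the_equality) (use h has_lev_unique in blast)
  with h show "lev H = enat n" by (auto simp: lev_def)
qed

definition Dom_Macc :: "real set set" where
  "Dom_Macc = {H. bounded H \<and> lev H < \<infinity>}"

text \<open>Only meaningful on \<open>Dom_Macc\<close>.\<close>

definition Macc :: "real set \<Rightarrow> real" where
  "Macc H = arith_mean (iter_derived (the_enat (lev H)) H)"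

text \<open>A partial function on sets of reals is given by its domain \<open>D\<close> together with a total
  function \<open>K\<close> of which only the values on \<open>D\<close> matter.

  Nonemptiness is explicit in \<open>generalized_mean\<close>: with the usual conventions
  \<open>inf {} = +\<infinity>\<close> and \<open>sup {} = -\<infinity>\<close> it is forced by \<open>inf H \<le> K H \<le> sup H\<close>,
  whereas the library's \<open>Inf {}\<close> and \<open>Sup {}\<close> are unspecified reals.\<close>

definition generalized_mean :: "real set set \<Rightarrow> (real set \<Rightarrow> real) \<Rightarrow> bool" where
  "generalized_mean D K \<longleftrightarrow>
     (\<forall>H\<in>D. bounded H \<and> H \<noteq> {} \<and> Inf H \<le> K H \<and> K H \<le> Sup H)"

definition strongly_internal_mean :: "real set set \<Rightarrow> (real set \<Rightarrow> real) \<Rightarrow> bool" where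
  "strongly_internal_mean D K \<longleftrightarrow>
     (\<forall>H\<in>D. infinite H \<longrightarrow> acc_liminf H \<le> K H \<and> K H \<le> acc_limsup H)"

definition finite_independent_mean :: "real set set \<Rightarrow> (real set \<Rightarrow> real) \<Rightarrow> bool" where
  "finite_independent_mean D K \<longleftrightarrow>
     (\<forall>H\<in>D. \<forall>V. infinite H \<and> finite V \<longrightarrow>
        H \<union> V \<in> D \<and> H - V \<in> D \<and> K H = K (H \<union> V) \<and> K H = K (H - V))"

definition shift_invariant_mean :: "real set set \<Rightarrow> (real set \<Rightarrow> real) \<Rightarrow> bool" where
  "shift_invariant_mean D K \<longleftrightarrow>
     (\<forall>x. \<forall>H\<in>D. (\<lambda>h. h + x) ` H \<in> D \<and> K ((\<lambda>h. h + x) ` H) = K H + x)"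

definition symmetric_mean :: "real set set \<Rightarrow> (real set \<Rightarrow> real) \<Rightarrow> bool" where
  "symmetric_mean D K \<longleftrightarrow>
     (\<forall>H\<in>D. \<forall>s. (\<forall>x. s + x \<in> H \<longleftrightarrow> s - x \<in> H) \<longrightarrow> K H = s)"

definition homogeneous_mean :: "real set set \<Rightarrow> (real set \<Rightarrow> real) \<Rightarrow> bool" where
  "homogeneous_mean D K \<longleftrightarrow>
     (\<forall>\<alpha>. \<forall>H\<in>D. (\<lambda>h. \<alpha> * h) ` H \<in> D \<and> K ((\<lambda>h. \<alpha> * h) ` H) = \<alpha> * K H)"

text \<open>Closed intervals may be degenerate or unbounded here.\<close>

definition convex_mean :: "real set set \<Rightarrow> (real set \<Rightarrow> real) \<Rightarrow> bool" where
  "convex_mean D K \<longleftrightarrow>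
     (\<forall>I H L. is_interval I \<and> closed I \<and> K H \<in> I \<and> L \<subseteq> I \<and> H \<in> D \<and> H \<union> L \<in> D
        \<longrightarrow> K (H \<union> L) \<in> I)"

definition closed_mean :: "real set set \<Rightarrow> (real set \<Rightarrow> real) \<Rightarrow> bool" where
  "closed_mean D K \<longleftrightarrow>
     (\<forall>H. H \<in> D \<and> closure H \<in> D \<longrightarrow> K (closure H) = K H)"

definition accumulated_mean :: "real set set \<Rightarrow> (real set \<Rightarrow> real) \<Rightarrow> bool" where
  "accumulated_mean D K \<longleftrightarrow>
     (\<forall>H. H \<in> D \<and> derived_set H \<in> D \<longrightarrow> K (derived_set H) = K H)"

end

theory Submission
  imports Defs
begin

text \<open>The derived set commutes with unions and nondegenerate affine maps, and it ignores finite
  changes and closures; so does its \<open>n\<close>-th iterate (for the latter two if \<open>n \<ge> 1\<close>).  Hence all the properties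
  reduce to elementary ones of the arithmetic mean of the finite set \<open>H\<^sup>(\<^sup>n\<^sup>)\<close>, which for \<open>n \<ge> 1\<close> is
  contained in \<open>H'\<close>.  Symmetry is equivariance under the reflection \<open>x \<mapsto> 2s - x\<close>.\<close>

section \<open>Algebra of iterated derived sets\<close>

lemma iter_derived_0 [simp]: "iter_derived 0 H = H"
  by (simp add: iter_derived_def)

lemma iter_derived_Suc: "iter_derived (Suc n) H = derived_set (iter_derived n H)"
  by (simp add: iter_derived_def)

text \<open>The inner form of the recursion: it moves one derivation onto the argument, which shifts
  levels by one in \<open>has_lev_Suc\<close>.\<close>

lemma iter_derived_Suc': "iter_derived (Suc n) H = iter_derived n (derived_set H)"
  by (simp add: iter_derived_def funpow_swap1)

lemma derived_set_Un: "derived_set (A \<union> B) = derived_set A \<union> derived_set B"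
  by (auto simp: derived_set_def islimpt_Un)

lemma iter_derived_Un: "iter_derived n (A \<union> B) = iter_derived n A \<union> iter_derived n B"
  by (induction n) (simp_all add: iter_derived_Suc derived_set_Un)

lemma derived_set_finite: "finite F \<Longrightarrow> derived_set F = {}"
  by (simp add: derived_set_def islimpt_finite)

lemma derived_set_Diff_finite:
  assumes "finite V"
  shows "derived_set (H - V) = derived_set H"
proof -
  have "derived_set H \<subseteq> derived_set ((H - V) \<union> V)"
    by (auto simp: derived_set_def elim: islimpt_subset)
  also have "\<dots> = derived_set (H - V)"
    unfolding derived_set_Un using derived_set_finite[OF assms] by blast
  finally have "derived_set H \<subseteq> derived_set (H - V)" .
  moreover have "derived_set (H - V) \<subseteq> derived_set H"
    by (auto simp: derived_set_def elim: islimpt_subset)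
  ultimately show ?thesis by blast
qed

lemma derived_set_closure: "derived_set (closure H) = derived_set H"
  by (simp add: derived_set_def limpt_of_closure)

lemma derived_set_subset_closed: "closed C \<Longrightarrow> A \<subseteq> C \<Longrightarrow> derived_set A \<subseteq> C"
  by (auto simp: derived_set_def closed_limpt dest: islimpt_subset)

text \<open>A closed set absorbs the limit points of its subsets, so it traps every iterate. Applied
  to \<open>closure H\<close>, to \<open>{Inf H..Sup H}\<close> and to the interval in the convexity
  property.\<close>

lemma iter_derived_subset_closed:
  assumes "closed C" "A \<subseteq> C"
  shows "iter_derived n A \<subseteq> C"
  using assms by (induction n) (simp_all add: iter_derived_Suc derived_set_subset_closed)

lemma bounded_iter_derived: "bounded H \<Longrightarrow> bounded (iter_derived n H)"
  by (meson bounded_closure bounded_subset closed_closure closure_subset iter_derived_subset_closed)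

text \<open>Bolzano-Weierstrass. It makes the last nonempty iterate of a bounded set finite, so that
  its arithmetic mean makes sense.\<close>

lemma finite_iff_derived_set_empty: "bounded H \<Longrightarrow> finite H \<longleftrightarrow> derived_set H = {}"
  using bounded_infinite_imp_islimpt[of H H] by (auto simp: derived_set_def islimpt_finite)

lemma derived_set_affine:
  fixes a b :: real
  assumes "a \<noteq> 0"
  shows "derived_set ((\<lambda>x. a * x + b) ` H) = (\<lambda>x. a * x + b) ` derived_set H"
proof -
  \<comment> \<open>Kept general in \<open>c\<close> and \<open>d\<close> so that it serves both the
    map and its inverse, one for each inclusion.\<close>
  have *: "c * x + d islimpt (\<lambda>x. c * x + d) ` S" if "x islimpt S" "c \<noteq> 0" for c d x :: real and S
    by (rule islimpt_isCont_image) (use that in \<open>auto simp: eventually_at_filter\<close>)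
  have "y \<in> (\<lambda>x. a * x + b) ` derived_set H" if "y islimpt (\<lambda>x. a * x + b) ` H" for y
  proof -
    have "(\<lambda>x. (1/a) * x + (-b/a)) ` (\<lambda>x. a * x + b) ` H = H"
      using assms by (simp add: image_image field_simps)
    then have "(1/a) * y + (-b/a) islimpt H"
      using *[OF that, of "1/a" "-b/a"] assms by simp
    moreover have "y = a * ((1/a) * y + (-b/a)) + b"
      using assms by (simp add: field_simps)
    ultimately show ?thesis
      by (auto simp: derived_set_def)
  qed
  then show ?thesis
    using * assms by (auto simp: derived_set_def)
qed

lemma iter_derived_affine:
  assumes "a \<noteq> 0"
  shows "iter_derived n ((\<lambda>x. a * x + b) ` H) = (\<lambda>x. a * x + b) ` iter_derived n H"
  by (induction n) (simp_all add: iter_derived_Suc derived_set_affine assms)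

section \<open>Levels and the domain of \<open>Macc\<close>\<close>

lemma Macc_eq: "has_lev H n \<Longrightarrow> Macc H = arith_mean (iter_derived n H)"
  using lev_eq_enat_iff[of H n] by (simp add: Macc_def)

lemma Dom_Macc_iff: "H \<in> Dom_Macc \<longleftrightarrow> bounded H \<and> (\<exists>n. has_lev H n)"
  by (auto simp: Dom_Macc_def simp flip: lev_eq_enat_iff)

lemma Dom_MaccE:
  assumes "H \<in> Dom_Macc"
  obtains n where "bounded H" "has_lev H n" "finite (iter_derived n H)" "iter_derived n H \<noteq> {}"
    "Macc H = arith_mean (iter_derived n H)"
proof -
  from assms obtain n where n: "bounded H" "has_lev H n"
    by (auto simp: Dom_Macc_iff)
  then have "finite (iter_derived n H)" "iter_derived n H \<noteq> {}"
    by (simp_all add: has_lev_def iter_derived_Suc finite_iff_derived_set_empty bounded_iter_derived)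
  with n show ?thesis
    using that by (simp add: Macc_eq)
qed

lemma has_lev_Suc: "has_lev H (Suc n) \<longleftrightarrow> has_lev (derived_set H) n"
  by (simp add: has_lev_def iter_derived_Suc')

lemma has_lev_0_iff: "bounded H \<Longrightarrow> has_lev H 0 \<longleftrightarrow> finite H \<and> H \<noteq> {}"
  by (auto simp: has_lev_def iter_derived_Suc finite_iff_derived_set_empty)

lemma Macc_finite: "finite H \<Longrightarrow> H \<noteq> {} \<Longrightarrow> Macc H = arith_mean H"
  using has_lev_0_iff[of H] Macc_eq[of H 0] by (simp add: finite_imp_bounded)

text \<open>A bounded infinite set cannot have level 0, so a finite level is a successor and passes,
  lowered by one, to the derived set.\<close>

lemma Dom_Macc_infinite_iff:
  assumes "infinite H"
  shows "H \<in> Dom_Macc \<longleftrightarrow> bounded H \<and> derived_set H \<in> Dom_Macc"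
proof -
  have "bounded H \<Longrightarrow> bounded (derived_set H)"
    using bounded_iter_derived[of H 1] by (simp add: iter_derived_Suc)
  moreover have "bounded H \<Longrightarrow> (\<exists>n. has_lev H n) \<longleftrightarrow> (\<exists>n. has_lev H (Suc n))"
    using assms has_lev_0_iff by (metis not0_implies_Suc)
  ultimately show ?thesis
    by (auto simp: Dom_Macc_iff has_lev_Suc)
qed

text \<open>The two levels differ by exactly one, so both means average the same last
  iterate.\<close>

lemma Macc_derived_set:
  assumes "derived_set H \<in> Dom_Macc"
  shows "Macc (derived_set H) = Macc H"
proof -
  from assms obtain n where "has_lev (derived_set H) n"
    by (auto simp: Dom_Macc_iff)
  then show ?thesis
    using Macc_eq[of H "Suc n"] by (simp add: Macc_eq has_lev_Suc iter_derived_Suc')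
qed

section \<open>Arithmetic means of finite sets\<close>

lemma arith_mean_in_convex:
  assumes "finite F" "F \<noteq> {}" "convex I" "F \<subseteq> I"
  shows "arith_mean F \<in> I"
proof -
  \<comment> \<open>The mean is the convex combination with equal weights.\<close>
  have "(\<Sum>x\<in>F. (1 / real (card F)) *\<^sub>R x) \<in> I"
    using assms by (intro convex_sum) auto
  then show ?thesis
    by (simp add: arith_mean_def flip: sum_divide_distrib)
qed

text \<open>Only the mean of \<open>F\<close>, not \<open>F\<close> itself, is known to lie in
  \<open>I\<close>. The mean of the union is a weighted average of the means of \<open>F\<close> and
  of \<open>G - F\<close>, with weights proportional to the cardinalities.\<close>

lemma arith_mean_Un_in_convex:
  assumes "finite F" "F \<noteq> {}" "finite G" "G \<subseteq> I" "convex I" "arith_mean F \<in> I"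
  shows "arith_mean (F \<union> G) \<in> I"
proof (cases "G \<subseteq> F")
  case True
  then show ?thesis
    using assms by (simp add: Un_absorb2)
next
  case False
  define E where "E = G - F"
  have E: "finite E" "E \<noteq> {}" "E \<subseteq> I" "E \<inter> F = {}" "F \<union> G = F \<union> E"
    using False assms by (auto simp: E_def)
  define m k where "m = real (card F)" and "k = real (card E)"
  have mk: "m > 0" "k > 0"
    using assms E by (auto simp: m_def k_def card_gt_0_iff)
  have "arith_mean (F \<union> G) = (m * arith_mean F + k * arith_mean E) / (m + k)"
    using mk E assms
    by (simp add: arith_mean_def sum.union_disjoint card_Un_disjoint Int_commute m_def k_def)
  also have "\<dots> = (m / (m + k)) *\<^sub>R arith_mean F + (k / (m + k)) *\<^sub>R arith_mean E"
    by (simp add: add_divide_distrib)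
  also have "\<dots> \<in> I"
    using mk assms E by (intro convexD arith_mean_in_convex[of E]) (simp_all flip: add_divide_distrib)
  finally show ?thesis .
qed

lemma arith_mean_affine:
  assumes "finite F" "F \<noteq> {}" "a \<noteq> 0"
  shows "arith_mean ((\<lambda>x. a * x + b) ` F) = a * arith_mean F + b"
proof -
  have inj: "inj_on (\<lambda>x. a * x + b) F"
    using assms by (auto simp: inj_on_def)
  have "card F > 0"
    using assms by (simp add: card_gt_0_iff)
  then show ?thesis
    by (simp add: arith_mean_def sum.reindex[OF inj] card_image[OF inj] sum.distrib
        sum_distrib_left add_divide_distrib)
qed

section \<open>Bounds, affine equivariance and dependence on the derived set\<close>

lemma subset_Icc_Inf_Sup: "bounded H \<Longrightarrow> H \<subseteq> {Inf H..Sup H}" for H :: "real set"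
  by (auto intro!: cInf_lower cSup_upper bounded_imp_bdd_above bounded_imp_bdd_below)

lemma Macc_bounds:
  assumes "H \<in> Dom_Macc"
  shows "Inf H \<le> Macc H" "Macc H \<le> Sup H"
proof -
  from assms obtain n where n: "bounded H" "finite (iter_derived n H)" "iter_derived n H \<noteq> {}"
    "Macc H = arith_mean (iter_derived n H)"
    by (rule Dom_MaccE)
  have "Macc H \<in> {Inf H..Sup H}"
    unfolding n(4) using n
    by (intro arith_mean_in_convex iter_derived_subset_closed subset_Icc_Inf_Sup) simp_all
  then show "Inf H \<le> Macc H" "Macc H \<le> Sup H"
    by auto
qed

text \<open>Common source of shift invariance (\<open>a = 1\<close>), homogeneity for nonzero
  factors (\<open>b = 0\<close>) and symmetry (\<open>a = - 1\<close>).\<close>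

lemma Dom_Macc_affine:
  assumes "H \<in> Dom_Macc" "a \<noteq> 0"
  shows "(\<lambda>x. a * x + b) ` H \<in> Dom_Macc" "Macc ((\<lambda>x. a * x + b) ` H) = a * Macc H + b"
proof -
  from assms(1) obtain n where n: "bounded H" "has_lev H n" "finite (iter_derived n H)"
    "iter_derived n H \<noteq> {}" "Macc H = arith_mean (iter_derived n H)"
    by (rule Dom_MaccE)
  have lev: "has_lev ((\<lambda>x. a * x + b) ` H) n"
    using n(2) assms(2) by (simp add: has_lev_def iter_derived_affine)
  have "bounded ((\<lambda>y. b + y) ` (\<lambda>x. a *\<^sub>R x) ` H)"
    using n(1) by (intro bounded_translation bounded_scaling)
  then have "bounded ((\<lambda>x. a * x + b) ` H)"
    by (simp add: image_image add.commute)
  with lev show "(\<lambda>x. a * x + b) ` H \<in> Dom_Macc"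
    by (auto simp: Dom_Macc_iff)
  show "Macc ((\<lambda>x. a * x + b) ` H) = a * Macc H + b"
    using lev n assms(2) by (simp add: Macc_eq iter_derived_affine arith_mean_affine)
qed

text \<open>Both membership in the domain and the value pass through the derived set. Finite
  independence and closedness are instances.\<close>

lemma Macc_cong_derived_set:
  assumes "H \<in> Dom_Macc" "infinite H" "bounded G" "derived_set G = derived_set H"
  shows "G \<in> Dom_Macc" "Macc G = Macc H"
proof -
  have D: "bounded H" "derived_set H \<in> Dom_Macc"
    using assms Dom_Macc_infinite_iff by blast+
  \<comment> \<open>\<open>derived_set G\<close> is nonempty because \<open>H\<close> is bounded and
    infinite.\<close>
  moreover have "infinite G"
    using assms D by (simp add: finite_iff_derived_set_empty)
  ultimately show "G \<in> Dom_Macc"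
    using assms Dom_Macc_infinite_iff by metis
  show "Macc G = Macc H"
    using D assms Macc_derived_set by metis
qed

section \<open>The properties of \<open>Macc\<close>\<close>

lemma generalized_mean_Macc: "generalized_mean Dom_Macc Macc"
  unfolding generalized_mean_def
proof (intro ballI conjI)
  fix H assume H: "H \<in> Dom_Macc"
  then show "bounded H"
    by (simp add: Dom_Macc_iff)
  obtain n where "iter_derived n H \<noteq> {}"
    using H by (auto simp: Dom_Macc_iff has_lev_def)
  then show "H \<noteq> {}"
    using iter_derived_empty_mono[of 0 H n] by auto
qed (rule Macc_bounds, assumption)+

text \<open>Since \<open>H\<close> and \<open>derived_set H\<close> have the same mean, this is the
  plain internality bound for \<open>derived_set H\<close>.\<close>

lemma strongly_internal_mean_Macc: "strongly_internal_mean Dom_Macc Macc"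
  unfolding strongly_internal_mean_def acc_liminf_def acc_limsup_def
proof (intro ballI impI)
  fix H assume "H \<in> Dom_Macc" "infinite H"
  then have "derived_set H \<in> Dom_Macc"
    using Dom_Macc_infinite_iff by blast
  then show "Inf (derived_set H) \<le> Macc H \<and> Macc H \<le> Sup (derived_set H)"
    using Macc_bounds[of "derived_set H"] by (simp add: Macc_derived_set)
qed

lemma finite_independent_mean_Macc: "finite_independent_mean Dom_Macc Macc"
  unfolding finite_independent_mean_def
proof (intro ballI allI impI)
  fix H V :: "real set"
  assume H: "H \<in> Dom_Macc" and "infinite H \<and> finite V"
  then have HV: "infinite H" "finite V" "bounded H"
    by (auto simp: Dom_Macc_iff)
  have "bounded (H \<union> V)" "derived_set (H \<union> V) = derived_set H"
    using HV by (simp_all add: finite_imp_bounded derived_set_Un derived_set_finite)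
  moreover have "bounded (H - V)" "derived_set (H - V) = derived_set H"
    using HV bounded_subset[of H "H - V"] by (simp_all add: derived_set_Diff_finite)
  ultimately show "H \<union> V \<in> Dom_Macc \<and> H - V \<in> Dom_Macc \<and> Macc H = Macc (H \<union> V) \<and> Macc H = Macc (H - V)"
    using Macc_cong_derived_set[OF H HV(1), of "H \<union> V"]
      Macc_cong_derived_set[OF H HV(1), of "H - V"] by simp
qed

lemma shift_invariant_mean_Macc: "shift_invariant_mean Dom_Macc Macc"
  unfolding shift_invariant_mean_def using Dom_Macc_affine[of _ 1] by simp

lemma symmetric_mean_Macc: "symmetric_mean Dom_Macc Macc"
  unfolding symmetric_mean_def
proof (intro ballI allI impI)
  fix H s assume H: "H \<in> Dom_Macc" and sym: "\<forall>x. s + x \<in> H \<longleftrightarrow> s - x \<in> H"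
  \<comment> \<open>The offset \<open>s - x\<close> turns symmetry about \<open>s\<close> into
    invariance under the reflection, whence the mean \<open>m\<close> satisfies
    \<open>m = 2 * s - m\<close>.\<close>
  have refl: "2 * s - x \<in> H \<longleftrightarrow> x \<in> H" for x
    using sym[rule_format, of "s - x"] by simp
  have "(\<lambda>x. - 1 * x + 2 * s) ` H = H"
  proof safe
    fix x assume "x \<in> H"
    then have "2 * s - x \<in> H"
      by (simp add: refl)
    then show "- 1 * x + 2 * s \<in> H" "x \<in> (\<lambda>x. - 1 * x + 2 * s) ` H"
      by (simp_all add: image_iff bexI[of _ "2 * s - x"])
  qed
  then have "Macc H = - 1 * Macc H + 2 * s"
    using Dom_Macc_affine(2)[OF H, of "- 1" "2 * s"] by (simp only:)
  then show "Macc H = s"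
    by linarith
qed

lemma homogeneous_mean_Macc: "homogeneous_mean Dom_Macc Macc"
  unfolding homogeneous_mean_def
proof (intro ballI allI)
  fix \<alpha> H assume H: "H \<in> Dom_Macc"
  show "(\<lambda>h. \<alpha> * h) ` H \<in> Dom_Macc \<and> Macc ((\<lambda>h. \<alpha> * h) ` H) = \<alpha> * Macc H"
  proof (cases "\<alpha> = 0")
    case True
    \<comment> \<open>The factor 0 gives no injective map and is treated directly. Nonemptiness
      makes the image \<open>{0}\<close> rather than \<open>{}\<close>, which has infinite
      level.\<close>
    have "H \<noteq> {}"
      using H generalized_mean_Macc by (auto simp: generalized_mean_def)
    then have "(\<lambda>h. \<alpha> * h) ` H = {0}"
      using True by auto
    moreover have "{0} \<in> Dom_Macc" "Macc {0} = 0"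
      using has_lev_0_iff[of "{0}"] by (auto simp: Dom_Macc_iff Macc_finite arith_mean_def)
    ultimately show ?thesis
      using True by simp
  next
    case False
    then show ?thesis
      using Dom_Macc_affine[OF H, of \<alpha> 0] by simp
  qed
qed

text \<open>At the level \<open>n\<close> of \<open>H \<union> L\<close>, the last iterate is the
  union of those of \<open>H\<close> and \<open>L\<close>, and the one of \<open>L\<close> stays in
  \<open>I\<close>. Either \<open>H\<close> has already died out, and only points of
  \<open>I\<close> are averaged, or \<open>H\<close> has level \<open>n\<close> too, and its mean in
  \<open>I\<close> is combined with points of \<open>I\<close>.\<close>

lemma convex_mean_Macc: "convex_mean Dom_Macc Macc"
  unfolding convex_mean_def
proof (intro allI impI, elim conjE)
  fix I H L
  assume I: "is_interval I" "closed I" "Macc H \<in> I" "L \<subseteq> I" and H: "H \<in> Dom_Macc"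
    and HL: "H \<union> L \<in> Dom_Macc"
  have "convex I"
    using I by (simp add: is_interval_convex)
  from HL obtain n where n: "has_lev (H \<union> L) n" "finite (iter_derived n (H \<union> L))"
    "iter_derived n (H \<union> L) \<noteq> {}" "Macc (H \<union> L) = arith_mean (iter_derived n (H \<union> L))"
    by (rule Dom_MaccE)
  have L: "iter_derived n L \<subseteq> I"
    using I by (intro iter_derived_subset_closed)
  show "Macc (H \<union> L) \<in> I"
  proof (cases "iter_derived n H = {}")
    case True
    with n L \<open>convex I\<close> show ?thesis
      by (auto simp: iter_derived_Un intro!: arith_mean_in_convex)
  next
    case False
    \<comment> \<open>The next iterate of \<open>H\<close> is contained in that of
      \<open>H \<union> L\<close>, which is empty.\<close>
    then have "has_lev H n"
      using n(1) by (simp add: has_lev_def iter_derived_Un)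
    then have "arith_mean (iter_derived n H) \<in> I"
      using I Macc_eq by simp
    with n L \<open>convex I\<close> False show ?thesis
      by (auto simp: iter_derived_Un intro!: arith_mean_Un_in_convex)
  qed
qed

text \<open>Finite sets are their own closure; infinite ones share their derived set with
  it.\<close>

lemma closed_mean_Macc: "closed_mean Dom_Macc Macc"
  unfolding closed_mean_def
proof (intro allI impI, elim conjE)
  fix H assume H: "H \<in> Dom_Macc" "closure H \<in> Dom_Macc"
  show "Macc (closure H) = Macc H"
  proof (cases "finite H")
    case True
    then show ?thesis
      by (simp add: finite_imp_closed)
  next
    case False
    then show ?thesis
      using H Macc_cong_derived_set(2)[of H "closure H"] by (simp add: Dom_Macc_iff derived_set_closure)
  qed
qed

lemma accumulated_mean_Macc: "accumulated_mean Dom_Macc Macc"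
  by (simp add: accumulated_mean_def Macc_derived_set)

theorem theorem3p12:
  "generalized_mean Dom_Macc Macc
   \<and> strongly_internal_mean Dom_Macc Macc
   \<and> finite_independent_mean Dom_Macc Macc
   \<and> shift_invariant_mean Dom_Macc Macc
   \<and> symmetric_mean Dom_Macc Macc
   \<and> homogeneous_mean Dom_Macc Macc
   \<and> convex_mean Dom_Macc Macc
   \<and> closed_mean Dom_Macc Macc
   \<and> accumulated_mean Dom_Macc Macc"
  by (intro conjI generalized_mean_Macc strongly_internal_mean_Macc finite_independent_mean_Macc
      shift_invariant_mean_Macc symmetric_mean_Macc homogeneous_mean_Macc convex_mean_Macc
      closed_mean_Macc accumulated_mean_Macc)

end
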